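(* For nonnegative integers $m,n$ let $H_{m,n}(u)=\sum_{k=0}^{\min(m,n)}\binom mk\binom nk k!\,u^k$. Then, as formal power series in $v,w,x,y,z$, \begin{multline*} \sum_{i,j,k,l,m\ge0}H_{i+2k+m,\,j+2l+m}(u)\frac{v^i}{i!}\frac{w^j}{j!}\frac{x^k}{k!}\frac{y^l}{l!}\frac{z^m}{m!} =\frac{1}{\sqrt{(1-uz)^2-4u^2xy}}\\ \times\exp\!\left(\frac{(1+uw)^2x+(1+uv)^2y+4uxy+(1-uz)(v+w+z+uvw)}{(1-uz)^2-4u^2xy}\right). \end{multline*} *)

theory Defs
  imports "HOL-Computational_Algebra.Formal_Power_Series"
begin

unbundle fps_syntax

definition Hpoly :: "nat \<Rightarrow> nat \<Rightarrow> 'a::field_char_0 \<Rightarrow> 'a" where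
  "Hpoly m n u = (\<Sum>k=0..min m n. of_nat (m choose k) * of_nat (n choose k) * fact k * u ^ k)"

text \<open>
  \<open>R[[v,w,x,y,z]]\<close> is represented as the iterated power series ring
  \<open>R[[z]][[y]][[x]][[w]][[v]]\<close>; the outermost layer is \<open>v\<close>.
  Addition, multiplication and powers are the library's.  The library's division is the
  intended one whenever the constant coefficient of the denominator is nonzero
  (see \<open>fps5_divide_mult\<close>).
\<close>

type_synonym 'a fps5 = "'a fps fps fps fps fps"

definition Abs_fps5 :: "(nat \<Rightarrow> nat \<Rightarrow> nat \<Rightarrow> nat \<Rightarrow> nat \<Rightarrow> 'a) \<Rightarrow> 'a fps5" where
  "Abs_fps5 c = Abs_fps (\<lambda>i. Abs_fps (\<lambda>j. Abs_fps (\<lambda>k. Abs_fps (\<lambda>l. Abs_fps (\<lambda>m. c i j k l m)))))"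

definition fps5_nth :: "'a fps5 \<Rightarrow> nat \<Rightarrow> nat \<Rightarrow> nat \<Rightarrow> nat \<Rightarrow> nat \<Rightarrow> 'a" where
  "fps5_nth f i j k l m = f $ i $ j $ k $ l $ m"

definition fps5_const :: "'a::zero \<Rightarrow> 'a fps5" where
  "fps5_const c = fps_const (fps_const (fps_const (fps_const (fps_const c))))"

definition var_v :: "'a::comm_ring_1 fps5" where "var_v = fps_X"
definition var_w :: "'a::comm_ring_1 fps5" where "var_w = fps_const fps_X"
definition var_x :: "'a::comm_ring_1 fps5" where "var_x = fps_const (fps_const fps_X)"
definition var_y :: "'a::comm_ring_1 fps5" where "var_y = fps_const (fps_const (fps_const fps_X))"
definition var_z :: "'a::comm_ring_1 fps5" where
  "var_z = fps_const (fps_const (fps_const (fps_const fps_X)))"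

text \<open>
  \<open>fps5_compose g F\<close> is \<open>\<Sum>n. g\<^sub>n F\<^sup>n\<close>, meaningful when \<open>F\<close> has zero constant coefficient.
  Then \<open>F\<^sup>n\<close> has no monomials of total degree below \<open>n\<close>, so truncating the sum at the total
  degree of the monomial loses nothing.  The library's \<open>fps_compose\<close> cannot be used on the
  iterated series: it requires the whole coefficient of \<open>v\<^sup>0\<close>, a series in \<open>w,x,y,z\<close>, to vanish.
\<close>

definition fps5_compose :: "'a::comm_ring_1 fps \<Rightarrow> 'a fps5 \<Rightarrow> 'a fps5" where
  "fps5_compose g F =
     Abs_fps5 (\<lambda>i j k l m. \<Sum>n\<le>i + j + k + l + m. g $ n * fps5_nth (F ^ n) i j k l m)"

definition fps5_exp :: "'a::field_char_0 fps5 \<Rightarrow> 'a fps5" where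
  "fps5_exp F = fps5_compose (fps_exp 1) F"

text \<open>
  For \<open>D\<close> with constant coefficient 1, the square root of \<open>D\<close> with constant coefficient 1, by
  the binomial series \<open>(1 + t)\<^sup>1\<^sup>/\<^sup>2\<close> at \<open>t = D - 1\<close> (see \<open>fps5_sqrt_square\<close>).
\<close>

definition fps5_sqrt :: "'a::field_char_0 fps5 \<Rightarrow> 'a fps5" where
  "fps5_sqrt D = fps5_compose (fps_binomial (1 / 2)) (D - 1)"

lemma fps5_nth_Abs [simp]: "fps5_nth (Abs_fps5 c) i j k l m = c i j k l m"
  by (simp add: fps5_nth_def Abs_fps5_def)

lemma fps5_eqI:
  assumes "\<And>i j k l m. fps5_nth f i j k l m = fps5_nth g i j k l m"
  shows "f = g"
  using assms by (simp add: fps5_nth_def fps_eq_iff)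

lemma fps5_mult_inverse:
  fixes D :: "'a::field fps5"
  assumes "fps5_nth D 0 0 0 0 0 \<noteq> 0"
  shows "D * inverse D = 1"
proof -
  have step: "f * inverse f = 1"
    if "f $ 0 * inverse (f $ 0) = 1" for f :: "'b::{comm_ring_1, inverse} fps"
    using fps_right_inverse[OF that] that
    by (simp add: fps_inverse_def fps_left_inverse_eq_fps_right_inverse_comm mult.commute)
  show ?thesis
    using assms unfolding fps5_nth_def by (intro step) simp
qed

lemma fps5_divide_mult:
  fixes N D :: "'a::field fps5"
  assumes "fps5_nth D 0 0 0 0 0 \<noteq> 0"
  shows "N / D * D = N"
proof -
  have "D $ 0 \<noteq> 0"
    using assms by (auto simp: fps5_nth_def)
  hence "N / D = N * inverse D"
    by (simp add: fps_divide_def)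
  thus ?thesis
    using fps5_mult_inverse[OF assms] by (simp add: mult.assoc mult.commute[of _ D])
qed

definition fps5_vanishes_below :: "nat \<Rightarrow> 'a::comm_ring_1 fps5 \<Rightarrow> bool" where
  "fps5_vanishes_below K f \<longleftrightarrow> (\<forall>i j k l m. i + j + k + l + m < K \<longrightarrow> fps5_nth f i j k l m = 0)"

lemma fps5_nth_mult:
  "fps5_nth (f * g) i j k l m =
     (\<Sum>a=0..i. \<Sum>b=0..j. \<Sum>c=0..k. \<Sum>d=0..l. \<Sum>e=0..m.
        fps5_nth f a b c d e * fps5_nth g (i - a) (j - b) (k - c) (l - d) (m - e))"
  for f g :: "'a::comm_ring_1 fps5"
  by (simp add: fps5_nth_def fps_mult_nth fps_sum_nth)

lemma fps5_vanishes_below_mult: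
  assumes "fps5_vanishes_below K f" "fps5_vanishes_below L g"
  shows "fps5_vanishes_below (K + L) (f * g)"
  unfolding fps5_vanishes_below_def fps5_nth_mult
proof (intro allI impI sum.neutral ballI)
  fix i j k l m a b c d e
  assume *: "i + j + k + l + m < K + L" "a \<in> {0..i}" "b \<in> {0..j}" "c \<in> {0..k}" "d \<in> {0..l}"
    "e \<in> {0..m}"
  have "a + b + c + d + e < K \<or> (i - a) + (j - b) + (k - c) + (l - d) + (m - e) < L"
    using * by auto
  thus "fps5_nth f a b c d e * fps5_nth g (i - a) (j - b) (k - c) (l - d) (m - e) = 0"
    using assms unfolding fps5_vanishes_below_def by (metis mult_zero_left mult_zero_right)
qed

lemma fps5_vanishes_below_power:
  assumes "fps5_nth F 0 0 0 0 0 = 0"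
  shows "fps5_vanishes_below n (F ^ n)"
proof (induction n)
  case (Suc n)
  have "fps5_vanishes_below 1 F"
    using assms by (simp add: fps5_vanishes_below_def)
  from fps5_vanishes_below_mult[OF this Suc] show ?case by simp
qed (simp add: fps5_vanishes_below_def)

lemma fps5_vanishes_below_mono:
  "fps5_vanishes_below L f \<Longrightarrow> K \<le> L \<Longrightarrow> fps5_vanishes_below K f"
  by (auto simp: fps5_vanishes_below_def)

lemma fps5_nth_add [simp]:
  "fps5_nth (f + g) i j k l m = fps5_nth f i j k l m + fps5_nth g i j k l m"
  by (simp add: fps5_nth_def)

lemma fps5_nth_diff [simp]:
  "fps5_nth (f - g) i j k l m = fps5_nth f i j k l m - fps5_nth g i j k l m"
  by (simp add: fps5_nth_def)

lemma fps5_nth_sum: "fps5_nth (sum f A) i j k l m = (\<Sum>n\<in>A. fps5_nth (f n) i j k l m)"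
  by (simp add: fps5_nth_def fps_sum_nth)

lemma fps5_nth_const_mult [simp]:
  "fps5_nth (fps5_const c * f) i j k l m = c * fps5_nth f i j k l m"
  for c :: "'a::comm_ring_1"
  by (simp add: fps5_nth_def fps5_const_def)

lemma fps5_vanishes_below_sum:
  "(\<And>n. n \<in> A \<Longrightarrow> fps5_vanishes_below K (f n)) \<Longrightarrow> fps5_vanishes_below K (sum f A)"
  by (auto simp: fps5_vanishes_below_def fps5_nth_sum intro!: sum.neutral)

lemma fps5_compose_truncate:
  assumes "fps5_nth F 0 0 0 0 0 = 0"
  shows "fps5_vanishes_below (Suc K) (fps5_compose g F - (\<Sum>n\<le>K. fps5_const (g $ n) * F ^ n))"
  unfolding fps5_vanishes_below_def
proof (intro allI impI)
  fix i j k l m assume *: "i + j + k + l + m < Suc K"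
  have "(\<Sum>n\<le>i + j + k + l + m. g $ n * fps5_nth (F ^ n) i j k l m) =
        (\<Sum>n\<le>K. g $ n * fps5_nth (F ^ n) i j k l m)"
    using * fps5_vanishes_below_power[OF assms]
    by (intro sum.mono_neutral_left) (auto simp: fps5_vanishes_below_def)
  thus "fps5_nth (fps5_compose g F - (\<Sum>n\<le>K. fps5_const (g $ n) * F ^ n)) i j k l m = 0"
    by (simp add: fps5_compose_def fps5_nth_sum)
qed

lemma fps5_const_mult: "fps5_const (a * b) = fps5_const a * fps5_const b"
  for a b :: "'a::comm_ring_1"
  by (simp add: fps5_const_def)

lemma fps5_const_sum: "fps5_const (sum f A) = (\<Sum>n\<in>A. fps5_const (f n))"
  for f :: "_ \<Rightarrow> 'a::comm_ring_1"
  by (induction A rule: infinite_finite_induct) (simp_all add: fps5_const_def flip: fps_const_add)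

lemma fps5_compose_mult:
  assumes F: "fps5_nth F 0 0 0 0 0 = 0"
  shows "fps5_compose (g * h) F = fps5_compose g F * fps5_compose h F"
proof (rule fps5_eqI)
  fix i j k l m :: nat
  define K where "K = i + j + k + l + m"
  define T where "T = (\<lambda>g::'a fps. \<Sum>n\<le>K. fps5_const (g $ n) * F ^ n)"
  note V = fps5_vanishes_below_def
  have tr: "fps5_vanishes_below (Suc K) (fps5_compose g F - T g)" for g
    unfolding T_def by (rule fps5_compose_truncate[OF F])
  have zero: "fps5_vanishes_below 0 f" for f :: "'a fps5"
    by (simp add: V)
  let ?S = "{..K} \<times> {..K}"
  let ?t = "\<lambda>(a, b). fps5_const (g $ a * h $ b) * F ^ (a + b)"
  have gh: "T g * T h = sum ?t ?S"
    unfolding T_def sum_product sum.cartesian_product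
    by (intro sum.cong) (auto simp: fps5_const_mult power_add mult_ac)
  let ?R = "{(a, b). a + b \<le> K}"
  have sub: "?R \<subseteq> ?S" by auto
  have "T (g * h) = (\<Sum>n\<le>K. \<Sum>a\<le>n. fps5_const (g $ a * h $ (n - a)) * F ^ (a + (n - a)))"
    unfolding T_def by (intro sum.cong)
      (auto simp: fps_mult_nth fps5_const_sum sum_distrib_right atLeast0AtMost intro!: sum.cong)
  also have "\<dots> = sum ?t ?R"
    by (rule sum.triangle_reindex_eq[symmetric])
  finally have "T g * T h - T (g * h) = sum ?t (?S - ?R)"
    using sum.subset_diff[OF sub, of ?t] gh by simp
  moreover have "fps5_vanishes_below (Suc K) (sum ?t (?S - ?R))"
  proof (rule fps5_vanishes_below_sum)
    fix p assume "p \<in> ?S - ?R"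
    then obtain a b where p: "p = (a, b)" and "\<not> a + b \<le> K" by auto
    hence "fps5_vanishes_below (Suc K) (F ^ (a + b))"
      by (intro fps5_vanishes_below_mono[OF fps5_vanishes_below_power[OF F]]) simp
    from fps5_vanishes_below_mult[OF zero this]
    show "fps5_vanishes_below (Suc K) (?t p)" by (simp add: p)
  qed
  ultimately have 1: "fps5_vanishes_below (Suc K) (T g * T h - T (g * h))" by simp
  have 2: "fps5_vanishes_below (Suc K) ((fps5_compose g F - T g) * fps5_compose h F)"
    using fps5_vanishes_below_mult[OF tr zero] by simp
  have 3: "fps5_vanishes_below (Suc K) (T g * (fps5_compose h F - T h))"
    using fps5_vanishes_below_mult[OF zero tr] by simp
  have "fps5_compose g F * fps5_compose h F - fps5_compose (g * h) F =
          (fps5_compose g F - T g) * fps5_compose h F + T g * (fps5_compose h F - T h) +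
          (T g * T h - T (g * h)) - (fps5_compose (g * h) F - T (g * h))"
    by (simp add: algebra_simps)
  hence "fps5_nth (fps5_compose g F * fps5_compose h F - fps5_compose (g * h) F) i j k l m = 0"
    using 1 2 3 tr[of "g * h"] unfolding V K_def
    by (simp only: fps5_nth_add fps5_nth_diff) simp
  thus "fps5_nth (fps5_compose (g * h) F) i j k l m =
        fps5_nth (fps5_compose g F * fps5_compose h F) i j k l m" by simp
qed

lemma fps5_nth_1: "fps5_nth 1 i j k l m = (if i + j + k + l + m = 0 then 1 else 0)"
  by (simp add: fps5_nth_def)

lemma fps5_sqrt_square:
  assumes "fps5_nth D 0 0 0 0 0 = 1"
  shows "fps5_sqrt D ^ 2 = D" and "fps5_nth (fps5_sqrt D) 0 0 0 0 0 = 1"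
proof -
  have F: "fps5_nth (D - 1) 0 0 0 0 0 = 0"
    using assms by (simp add: fps5_nth_1)
  have "fps5_sqrt D ^ 2 = fps5_compose (1 + fps_X) (D - 1)"
    unfolding fps5_sqrt_def power2_eq_square fps5_compose_mult[OF F, symmetric]
    by (simp flip: fps_binomial_add_mult add: fps_binomial_1)
  also have "\<dots> = D"
  proof (rule fps5_eqI)
    fix i j k l m
    have "fps5_nth (fps5_compose (1 + fps_X) (D - 1)) i j k l m =
            (\<Sum>n\<in>{0, 1} \<inter> {..i + j + k + l + m}. fps5_nth ((D - 1) ^ n) i j k l m)"
      unfolding fps5_compose_def fps5_nth_Abs
      by (intro sum.mono_neutral_cong_right) auto
    also have "\<dots> = fps5_nth D i j k l m"
      using assms
      by (cases "i + j + k + l + m = 0") (auto simp: fps5_nth_1 Int_insert_left)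
    finally show "fps5_nth (fps5_compose (1 + fps_X) (D - 1)) i j k l m = fps5_nth D i j k l m" .
  qed
  finally show "fps5_sqrt D ^ 2 = D" .
  show "fps5_nth (fps5_sqrt D) 0 0 0 0 0 = 1"
    by (simp add: fps5_sqrt_def fps5_compose_def fps5_nth_1)
qed

lemma fps5_nth_monomial:
  "fps5_nth (var_v ^ a * var_w ^ b * var_x ^ c * var_y ^ d * var_z ^ e :: 'a::comm_ring_1 fps5) i j k l m =
     (if i = a \<and> j = b \<and> k = c \<and> l = d \<and> m = e then 1 else 0)"
  by (simp add: fps5_nth_def var_v_def var_w_def var_x_def var_y_def var_z_def fps_const_power
        fps_X_power_nth fps_mult_right_const_nth)

end

theory Submission
  imports Defs
begin

text \<open>
  Both sides satisfy the heat-type equations \<open>G\<^sub>x = G\<^sub>v\<^sub>v\<close>, \<open>G\<^sub>y = G\<^sub>w\<^sub>w\<close>, \<open>G\<^sub>z = G\<^sub>v\<^sub>w\<close>: on the left because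
  \<open>x\<close>, \<open>y\<close>, \<open>z\<close> shift the indices of \<open>H\<close> by \<open>(2,0)\<close>, \<open>(0,2)\<close>, \<open>(1,1)\<close>, on the right by polynomial
  identities between the numerator \<open>Q\<close> and the denominator \<open>D\<close> of the exponent.  These equations
  determine a series from its restriction to \<open>x = y = z = 0\<close>, where the right-hand side becomes
  \<open>exp (v + w + u v w)\<close>, i.e. the solution of \<open>G\<^sub>v = (1 + u w) G\<close> with \<open>G = exp w\<close> at \<open>v = 0\<close>;
  on coefficients this is the Pascal-type recurrence of \<open>H\<close>.
\<close>

section \<open>Derivations of commutative rings\<close>

locale derivation =
  fixes d :: "'b::comm_ring_1 \<Rightarrow> 'b"
  assumes add: "d (f + g) = d f + d g"
    and mult: "d (f * g) = d f * g + f * d g"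
begin

lemma zero: "d 0 = 0"
  using add[of 0 0] by simp

lemma one: "d 1 = 0"
  using mult[of 1 1] by simp

lemma minus: "d (- f) = - d f"
  using add[of "- f" f] zero by (simp add: eq_neg_iff_add_eq_0)

lemma diff: "d (f - g) = d f - d g"
  using add[of f "- g"] minus[of g] by simp

lemma sum: "d (sum f A) = (\<Sum>n\<in>A. d (f n))"
  by (induction A rule: infinite_finite_induct) (simp_all add: zero add)

lemma of_nat: "d (of_nat n) = 0"
  by (induction n) (simp_all add: zero one add)

lemma numeral: "d (numeral n) = 0"
  using of_nat[of "numeral n"] by simp

lemma power_Suc: "d (f ^ Suc n) = of_nat (Suc n) * f ^ n * d f"
  by (induction n) (simp_all add: mult one algebra_simps)

lemma power2: "d (f ^ 2) = 2 * f * d f"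
  using power_Suc[of f 1] by (simp add: power2_eq_square)

lemmas rules = zero one minus add diff mult numeral power2

end

section \<open>Partial derivatives of series in five variables\<close>

definition fps_map :: "('b \<Rightarrow> 'c) \<Rightarrow> 'b fps \<Rightarrow> 'c fps" where
  "fps_map h f = Abs_fps (\<lambda>n. h (f $ n))"

lemma fps_map_nth [simp]: "fps_map h f $ n = h (f $ n)"
  by (simp add: fps_map_def)

lemma derivation_fps_deriv: "derivation fps_deriv"
  by unfold_locales simp_all

text \<open>Leibniz passes to coefficients because a coefficient of a product is a finite sum of
  products. Iteration makes differentiation in an inner variable a derivation of the whole iterated
  ring.\<close>

lemma derivation_fps_map:
  assumes "derivation d"
  shows "derivation (fps_map d)"
proof -
  interpret derivation d by fact
  show ?thesis
    by unfold_locales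
      (simp_all add: fps_eq_iff add fps_mult_nth sum mult sum.distrib)
qed

definition deriv_v :: "'a::comm_ring_1 fps5 \<Rightarrow> 'a fps5" where "deriv_v = fps_deriv"
definition deriv_w :: "'a::comm_ring_1 fps5 \<Rightarrow> 'a fps5" where "deriv_w = fps_map fps_deriv"
definition deriv_x :: "'a::comm_ring_1 fps5 \<Rightarrow> 'a fps5" where
  "deriv_x = fps_map (fps_map fps_deriv)"
definition deriv_y :: "'a::comm_ring_1 fps5 \<Rightarrow> 'a fps5" where
  "deriv_y = fps_map (fps_map (fps_map fps_deriv))"
definition deriv_z :: "'a::comm_ring_1 fps5 \<Rightarrow> 'a fps5" where
  "deriv_z = fps_map (fps_map (fps_map (fps_map fps_deriv)))"

lemmas deriv_defs = deriv_v_def deriv_w_def deriv_x_def deriv_y_def deriv_z_def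
lemmas var_defs = var_v_def var_w_def var_x_def var_y_def var_z_def

lemma fps5_nth_deriv:
  "fps5_nth (deriv_v f) i j k l m = of_nat (Suc i) * fps5_nth f (Suc i) j k l m"
  "fps5_nth (deriv_w f) i j k l m = of_nat (Suc j) * fps5_nth f i (Suc j) k l m"
  "fps5_nth (deriv_x f) i j k l m = of_nat (Suc k) * fps5_nth f i j (Suc k) l m"
  "fps5_nth (deriv_y f) i j k l m = of_nat (Suc l) * fps5_nth f i j k (Suc l) m"
  "fps5_nth (deriv_z f) i j k l m = of_nat (Suc m) * fps5_nth f i j k l (Suc m)"
  by (simp_all add: fps5_nth_def deriv_defs fps_mult_left_const_nth flip: fps_of_nat
      del: of_nat_Suc)

text \<open>\<open>vanishes_below\<close> plays the role of continuity: a series known modulo high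
  degree has its derivative known modulo one degree less, so a composition can be differentiated
  through its truncations.\<close>

locale fps5_derivation = derivation d for d :: "'a::field_char_0 fps5 \<Rightarrow> 'a fps5" +
  assumes const: "d (fps5_const c) = 0"
    and vanishes_below: "fps5_vanishes_below (Suc K) f \<Longrightarrow> fps5_vanishes_below K (d f)"
begin

text \<open>Each term differentiates to \<open>d F\<close> times the preceding term and the constant
  term dies, hence the two different truncation orders.\<close>

lemma exp_truncation:
  "d (\<Sum>n\<le>Suc K. fps5_const (fps_exp 1 $ n) * F ^ n) =
   d F * (\<Sum>n\<le>K. fps5_const (fps_exp 1 $ n) * F ^ n)"
proof -
  have of_nat: "of_nat n = fps5_const (of_nat n :: 'a)" for n
    by (simp add: fps5_const_def fps_of_nat)
  have step: "d (fps5_const (fps_exp 1 $ Suc n) * F ^ Suc n) =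
      d F * (fps5_const (fps_exp 1 $ n) * F ^ n)" for n
  proof -
    have "fps_exp 1 $ Suc n * of_nat (Suc n) = (fps_exp 1 $ n :: 'a)"
      by (simp only: fps_exp_nth power_one of_nat_fact fact_Suc[where 'a = 'a])
        (simp del: of_nat_Suc)
    hence "fps5_const (fps_exp 1 $ Suc n) * of_nat (Suc n) = fps5_const (fps_exp 1 $ n :: 'a)"
      by (simp only: of_nat fps5_const_mult[symmetric])
    thus ?thesis
      by (simp only: mult const power_Suc mult_zero_left add_0 mult.assoc[symmetric])
        (simp only: mult_ac)
  qed
  show ?thesis
    by (subst sum.atMost_Suc_shift)
      (simp only: add sum step, simp add: mult const one sum_distrib_left)
qed

text \<open>The termwise computation is valid modulo any given degree; \<open>d\<close> costs one degree.\<close>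

lemma exp:
  assumes F: "fps5_nth F 0 0 0 0 0 = 0"
  shows "d (fps5_exp F) = d F * fps5_exp F"
proof (rule fps5_eqI)
  fix i j k l m :: nat
  define K where "K = i + j + k + l + m"
  define T where "T K = (\<Sum>n\<le>K. fps5_const (fps_exp 1 $ n) * F ^ n)" for K
  have tr: "fps5_vanishes_below (Suc K) (fps5_exp F - T K)" for K
    unfolding T_def fps5_exp_def by (rule fps5_compose_truncate[OF F])
  have "fps5_vanishes_below (Suc K) (d (fps5_exp F - T (Suc K)))"
    by (intro vanishes_below tr)
  moreover have "fps5_vanishes_below (0 + Suc K) (d F * (fps5_exp F - T K))"
    by (intro fps5_vanishes_below_mult tr) (simp add: fps5_vanishes_below_def)
  moreover have "d (T (Suc K)) = d F * T K"
    unfolding T_def by (rule exp_truncation)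
  ultimately show "fps5_nth (d (fps5_exp F)) i j k l m = fps5_nth (d F * fps5_exp F) i j k l m"
    by (simp add: fps5_vanishes_below_def K_def diff right_diff_distrib)
qed

text \<open>Logarithmic differentiation of \<open>R = D\<^sup>-\<^sup>1\<^sup>/\<^sup>2 exp (Q/D)\<close>, with denominators cleared.\<close>

lemma gaussian:
  assumes D: "fps5_nth D 0 0 0 0 0 = 1" and Q: "fps5_nth Q 0 0 0 0 0 = 0"
  defines "R \<equiv> 1 / fps5_sqrt D * fps5_exp (Q / D)"
  shows "2 * D ^ 2 * d R = (2 * (d Q * D - Q * d D) - d D * D) * R"
proof -
  define S E where "S = fps5_sqrt D" and "E = Q / D"
  have S: "S ^ 2 = D" "fps5_nth S 0 0 0 0 0 = 1"
    using fps5_sqrt_square[OF D] by (simp_all add: S_def)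
  have ED: "E * D = Q"
    unfolding E_def by (rule fps5_divide_mult) (simp add: D)
  hence "fps5_nth (E * D) 0 0 0 0 0 = 0" using Q by simp
  hence E0: "fps5_nth E 0 0 0 0 0 = 0" using D by (simp add: fps5_nth_mult)
  have "1 / S * S = 1"
    by (rule fps5_divide_mult) (simp add: S)
  moreover have "S * R = (1 / S * S) * fps5_exp E"
    unfolding R_def S_def E_def by (simp only: mult_ac)
  ultimately have SR: "S * R = fps5_exp E"
    by simp
  have "d S * R + S * d R = d E * (S * R)"
    using exp[OF E0] mult[of S R] by (simp only: SR)
  \<comment> \<open>The factor \<open>2 * S\<close> turns \<open>d S\<close> into
    \<open>d D\<close>. One factor \<open>D\<close> turns \<open>d E\<close> into
    \<open>d Q - E * d D\<close>, the other turns the remaining \<open>E\<close> into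
    \<open>Q\<close>.\<close>
  hence 1: "2 * S * D * D * (d S * R + S * d R) = 2 * S * D * D * (d E * (S * R))"
    by (simp only:)
  have 2: "d D = 2 * S * d S"
    using power2[of S] by (simp only: S)
  have 3: "d Q = d E * D + E * d D"
    using mult[of E D] by (simp only: ED)
  have "D * (2 * D ^ 2 * d R) = 2 * S * D * D * (S * d R)"
    by (simp add: S(1)[symmetric] power2_eq_square mult_ac)
  also have "\<dots> = 2 * S * D * D * (d E * (S * R)) - D * D * (2 * S * d S) * R"
    using 1 by (simp add: algebra_simps)
  also have "\<dots> = D * ((2 * (d Q * D - Q * d D) - d D * D) * R)"
    using 2 3 ED S(1) by algebra
  \<comment> \<open>The surplus factor \<open>D\<close> is nonzero and cancels.\<close>
  finally show ?thesis
    using D by (auto simp: fps5_nth_def)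
qed

end

section \<open>The five partial derivatives as instances, and their values on the variables\<close>

lemma fps5_derivation_derivs:
  "fps5_derivation (deriv_v :: 'a::field_char_0 fps5 \<Rightarrow> _)"
  "fps5_derivation (deriv_w :: 'a::field_char_0 fps5 \<Rightarrow> _)"
  "fps5_derivation (deriv_x :: 'a::field_char_0 fps5 \<Rightarrow> _)"
  "fps5_derivation (deriv_y :: 'a::field_char_0 fps5 \<Rightarrow> _)"
  "fps5_derivation (deriv_z :: 'a::field_char_0 fps5 \<Rightarrow> _)"
proof -
  have "derivation (deriv_v :: 'a fps5 \<Rightarrow> _)" "derivation (deriv_w :: 'a fps5 \<Rightarrow> _)"
    "derivation (deriv_x :: 'a fps5 \<Rightarrow> _)" "derivation (deriv_y :: 'a fps5 \<Rightarrow> _)"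
    "derivation (deriv_z :: 'a fps5 \<Rightarrow> _)"
    unfolding deriv_defs by (intro derivation_fps_map derivation_fps_deriv)+
  moreover have const: "fps5_nth (fps5_const c) i j k l m = (if i + j + k + l + m = 0 then c else 0)"
    for c :: 'a and i j k l m
    by (simp add: fps5_nth_def fps5_const_def)
  moreover have "fps5_nth 0 i j k l m = (0::'a)" for i j k l m
    by (simp add: fps5_nth_def)
  ultimately show
    "fps5_derivation (deriv_v :: 'a fps5 \<Rightarrow> _)" "fps5_derivation (deriv_w :: 'a fps5 \<Rightarrow> _)"
    "fps5_derivation (deriv_x :: 'a fps5 \<Rightarrow> _)" "fps5_derivation (deriv_y :: 'a fps5 \<Rightarrow> _)"
    "fps5_derivation (deriv_z :: 'a fps5 \<Rightarrow> _)"
    unfolding fps5_derivation_def fps5_derivation_axioms_def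
    by (auto simp: fps5_vanishes_below_def fps5_nth_deriv intro!: fps5_eqI)
qed

interpretation dv: fps5_derivation "deriv_v :: 'a::field_char_0 fps5 \<Rightarrow> _"
  by (rule fps5_derivation_derivs)
interpretation dw: fps5_derivation "deriv_w :: 'a::field_char_0 fps5 \<Rightarrow> _"
  by (rule fps5_derivation_derivs)
interpretation dx: fps5_derivation "deriv_x :: 'a::field_char_0 fps5 \<Rightarrow> _"
  by (rule fps5_derivation_derivs)
interpretation dy: fps5_derivation "deriv_y :: 'a::field_char_0 fps5 \<Rightarrow> _"
  by (rule fps5_derivation_derivs)
interpretation dz: fps5_derivation "deriv_z :: 'a::field_char_0 fps5 \<Rightarrow> _"
  by (rule fps5_derivation_derivs)

lemma deriv_var:
  "deriv_v var_v = 1" "deriv_v var_w = 0" "deriv_v var_x = 0" "deriv_v var_y = 0" "deriv_v var_z = 0"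
  "deriv_w var_v = 0" "deriv_w var_w = 1" "deriv_w var_x = 0" "deriv_w var_y = 0" "deriv_w var_z = 0"
  "deriv_x var_v = 0" "deriv_x var_w = 0" "deriv_x var_x = 1" "deriv_x var_y = 0" "deriv_x var_z = 0"
  "deriv_y var_v = 0" "deriv_y var_w = 0" "deriv_y var_x = 0" "deriv_y var_y = 1" "deriv_y var_z = 0"
  "deriv_z var_v = 0" "deriv_z var_w = 0" "deriv_z var_x = 0" "deriv_z var_y = 0" "deriv_z var_z = 1"
  by (auto simp: deriv_defs var_defs fps_eq_iff fps_nth_fps_const)

lemmas deriv_rules = dv.rules dw.rules dx.rules dy.rules dz.rules

lemma fps5_nth_var_mult:
  "fps5_nth (var_v * f) i j k l m = (if i = 0 then 0 else fps5_nth f (i - 1) j k l m)"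
  "fps5_nth (var_w * f) i j k l m = (if j = 0 then 0 else fps5_nth f i (j - 1) k l m)"
  "fps5_nth (var_x * f) i j k l m = (if k = 0 then 0 else fps5_nth f i j (k - 1) l m)"
  "fps5_nth (var_y * f) i j k l m = (if l = 0 then 0 else fps5_nth f i j k (l - 1) m)"
  "fps5_nth (var_z * f) i j k l m = (if m = 0 then 0 else fps5_nth f i j k l (m - 1))"
  by (simp_all add: fps5_nth_def var_defs)

section \<open>Recurrences of the polynomials \<open>Hpoly\<close>\<close>

lemma Hpoly_eq_sum_atMost:
  "Hpoly m n u = (\<Sum>k\<le>n. of_nat (m choose k) * of_nat (n choose k) * fact k * u ^ k)"
  unfolding Hpoly_def by (intro sum.mono_neutral_left) auto

lemma Hpoly_0_left: "Hpoly 0 n u = 1"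
  by (simp add: Hpoly_def)

lemma Hpoly_Suc_0: "Hpoly (Suc m) 0 u = Hpoly m 0 u"
  by (simp add: Hpoly_def)

text \<open>Pascal's rule for \<open>Suc m choose k\<close> splits the sum. In the shifted half,
  (n+1 choose k+1) (k+1)! = (n+1) (n choose k) k! extracts the factor \<open>Suc n\<close>.\<close>

lemma Hpoly_Suc_Suc:
  "Hpoly (Suc m) (Suc n) u = Hpoly m (Suc n) u + u * of_nat (Suc n) * Hpoly m n u"
proof -
  have absorb: "of_nat (Suc n choose Suc k) * fact (Suc k) =
      of_nat (Suc n) * of_nat (n choose k) * (fact k :: 'a)" for k
  proof -
    have "of_nat (Suc k * (Suc n choose Suc k)) = (of_nat (Suc n * (n choose k)) :: 'a)"
      by (simp only: Suc_times_binomial_eq mult.commute)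
    thus ?thesis
      by (simp only: fact_Suc of_nat_mult) (metis mult.assoc mult.commute)
  qed
  have "Hpoly (Suc m) (Suc n) u =
      Hpoly m (Suc n) u + (\<Sum>k\<le>n. of_nat (m choose k) *
        (of_nat (Suc n choose Suc k) * fact (Suc k)) * u ^ Suc k)"
    unfolding Hpoly_eq_sum_atMost sum.atMost_Suc_shift[of _ n]
    by (simp only: binomial_Suc_Suc[of m] of_nat_add ring_distribs sum.distrib mult.assoc binomial_n_0)
      (simp add: algebra_simps)
  also have "(\<Sum>k\<le>n. of_nat (m choose k) *
        (of_nat (Suc n choose Suc k) * fact (Suc k)) * u ^ Suc k) = u * of_nat (Suc n) * Hpoly m n u"
    unfolding Hpoly_eq_sum_atMost absorb sum_distrib_left
    by (intro sum.cong) (simp_all add: mult_ac)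
  finally show ?thesis .
qed

section \<open>The heat-type equations and the initial data\<close>

theorem theorem5p5:
  fixes u :: "'a::field_char_0"
  shows
    "(let U = fps5_const u; v = var_v; w = var_w; x = var_x; y = var_y; z = var_z;
          D = (1 - U * z)^2 - 4 * U^2 * x * y
      in Abs_fps5 (\<lambda>i j k l m.
           Hpoly (i + 2 * k + m) (j + 2 * l + m) u / (fact i * fact j * fact k * fact l * fact m))
         = 1 / fps5_sqrt D *
           fps5_exp (((1 + U * w)^2 * x + (1 + U * v)^2 * y + 4 * U * x * y
                       + (1 - U * z) * (v + w + z + U * v * w)) / D))"
proof -
  define U where "U = fps5_const u"
  define v w x y z :: "'a fps5" where vars: "v = var_v" "w = var_w" "x = var_x" "y = var_y" "z = var_z"
  define D where "D = (1 - U * z)^2 - 4 * U^2 * x * y"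
  define Q where "Q = (1 + U * w)^2 * x + (1 + U * v)^2 * y + 4 * U * x * y
                       + (1 - U * z) * (v + w + z + U * v * w)"
  define R where "R = 1 / fps5_sqrt D * fps5_exp (Q / D)"
  have U: "deriv_v U = 0" "deriv_w U = 0" "deriv_x U = 0" "deriv_y U = 0" "deriv_z U = 0"
    by (simp_all add: U_def dv.const dw.const dx.const dy.const dz.const)
  note rules = deriv_rules deriv_var U vars
  have D0: "fps5_nth D 0 0 0 0 0 = 1"
    by (simp add: D_def U_def vars fps5_nth_def var_defs power2_eq_square)
  have Q0: "fps5_nth Q 0 0 0 0 0 = 0"
    by (simp add: Q_def U_def vars fps5_nth_def var_defs power2_eq_square)
  have nz: "D \<noteq> 0"
    using D0 by (auto simp: fps5_nth_def)

  \<comment> \<open>\<open>A\<close> and \<open>B\<close> are the derivatives of \<open>Q\<close> in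
    \<open>v\<close> and \<open>w\<close>. As \<open>D\<close> is free of \<open>v\<close> and
    \<open>w\<close>, they are also \<open>D\<close> times the logarithmic derivatives of
    \<open>R\<close>.\<close>
  define A where "A = 2 * U * (1 + U * v) * y + (1 - U * z) * (1 + U * w)"
  define B where "B = 2 * U * (1 + U * w) * x + (1 - U * z) * (1 + U * v)"
  have D_derivs: "deriv_v D = 0" "deriv_w D = 0" "deriv_x D = - 4 * U^2 * y"
      "deriv_y D = - 4 * U^2 * x" "deriv_z D = - 2 * U * (1 - U * z)"
    by (simp_all add: D_def rules algebra_simps)
  have Q_derivs: "deriv_v Q = A" "deriv_w Q = B"
      "deriv_x Q = (1 + U * w)^2 + 4 * U * y" "deriv_y Q = (1 + U * v)^2 + 4 * U * x"
      "deriv_z Q = (1 - U * z) - U * (v + w + z + U * v * w)"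
    by (simp_all add: Q_def A_def B_def rules algebra_simps)
  have AB_derivs: "deriv_v A = 2 * U^2 * y" "deriv_w B = 2 * U^2 * x"
      "deriv_v B = U * (1 - U * z)"
    by (simp_all add: A_def B_def rules power2_eq_square algebra_simps)

  note R_derivs = dv.gaussian[OF D0 Q0, folded R_def, unfolded D_derivs Q_derivs]
    dw.gaussian[OF D0 Q0, folded R_def, unfolded D_derivs Q_derivs]
    dx.gaussian[OF D0 Q0, folded R_def, unfolded D_derivs Q_derivs]
    dy.gaussian[OF D0 Q0, folded R_def, unfolded D_derivs Q_derivs]
    dz.gaussian[OF D0 Q0, folded R_def, unfolded D_derivs Q_derivs]
  have Rv: "D * deriv_v R = A * R" and Rw: "D * deriv_w R = B * R"
    using R_derivs(1,2) nz by (auto simp: power2_eq_square mult_ac)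
  \<comment> \<open>This brings second derivatives to the form \<open>2 * D ^ 2 * c = p * R\<close>,
    the one \<open>gaussian\<close> gives for the derivatives in \<open>x\<close>, \<open>y\<close>,
    \<open>z\<close>. Each heat-type equation then reduces to equality of two polynomial factors of
    \<open>R\<close>.\<close>
  have second: "2 * D ^ 2 * c = (2 * D * a + 2 * b * b') * R"
    if "D * c = a * R + b * r" "D * r = b' * R" for a b b' c r
  proof -
    have "2 * D ^ 2 * c = 2 * D * (D * c)" by (simp add: power2_eq_square)
    also have "\<dots> = 2 * D * a * R + 2 * b * (D * r)" by (simp add: that(1) algebra_simps)
    finally show ?thesis by (simp add: that(2) algebra_simps)
  qed
  have "D * deriv_v (deriv_v R) = 2 * U^2 * y * R + A * deriv_v R"
    using arg_cong[OF Rv, of deriv_v] by (simp add: dv.mult D_derivs AB_derivs)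
  note Rvv = second[OF this Rv]
  have "D * deriv_w (deriv_w R) = 2 * U^2 * x * R + B * deriv_w R"
    using arg_cong[OF Rw, of deriv_w] by (simp add: dw.mult D_derivs AB_derivs)
  note Rww = second[OF this Rw]
  have "D * deriv_v (deriv_w R) = U * (1 - U * z) * R + B * deriv_v R"
    using arg_cong[OF Rw, of deriv_v] by (simp add: dv.mult D_derivs AB_derivs)
  note Rvw = second[OF this Rv]
  have cancel: "f = g" if "2 * D ^ 2 * f = a * R" "2 * D ^ 2 * g = b * R" "a = b" for f g a b
    using that nz by (metis mult_cancel_left mult_eq_0_iff power_not_zero zero_neq_numeral)
  have Rx: "deriv_x R = deriv_v (deriv_v R)"
    by (rule cancel[OF R_derivs(3) Rvv], unfold A_def D_def Q_def) algebra
  have Ry: "deriv_y R = deriv_w (deriv_w R)"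
    by (rule cancel[OF R_derivs(4) Rww], unfold B_def D_def Q_def) algebra
  have Rz: "deriv_z R = deriv_v (deriv_w R)"
    by (rule cancel[OF R_derivs(5) Rvw], unfold A_def B_def D_def Q_def) algebra

  \<comment> \<open>With the factorials restored, each partial derivative is a shift of one index by
    1, so the heat-type equations become pure index shifts.\<close>
  define h where "h i j k l m = fact i * fact j * fact k * fact l * fact m * fps5_nth R i j k l m"
    for i j k l m
  have hx: "h i j (Suc k) l m = h (Suc (Suc i)) j k l m" for i j k l m
    using arg_cong[OF Rx, of "\<lambda>f. fps5_nth f i j k l m"]
    by (simp add: h_def fps5_nth_deriv mult_ac del: of_nat_Suc)
  have hy: "h i j k (Suc l) m = h i (Suc (Suc j)) k l m" for i j k l m
    using arg_cong[OF Ry, of "\<lambda>f. fps5_nth f i j k l m"]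
    by (simp add: h_def fps5_nth_deriv mult_ac del: of_nat_Suc)
  have hz: "h i j k l (Suc m) = h (Suc i) (Suc j) k l m" for i j k l m
    using arg_cong[OF Rz, of "\<lambda>f. fps5_nth f i j k l m"]
    by (simp add: h_def fps5_nth_deriv mult_ac del: of_nat_Suc)
  have red_x: "h i j k l m = h (i + 2 * k) j 0 l m" for i j k l m
    by (induction k arbitrary: i) (simp_all add: hx)
  have red_y: "h i j k l m = h i (j + 2 * l) k 0 m" for i j k l m
    by (induction l arbitrary: j) (simp_all add: hy)
  have red_z: "h i j k l m = h (i + m) (j + m) k l 0" for i j k l m
    by (induction m arbitrary: i j) (simp_all add: hz)
  have red: "h i j k l m = h (i + 2 * k + m) (j + 2 * l + m) 0 0 0" for i j k l m
    using red_x[of i j k l m] red_y[of "i + 2 * k" j 0 l m] red_z[of "i + 2 * k" "j + 2 * l" 0 0 m]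
    by simp

  \<comment> \<open>\<open>Rv\<close> with the 1 in \<open>D\<close> isolated: everything outside
    \<open>R + U * (w * R)\<close> is a multiple of \<open>y\<close> or \<open>z\<close> and drops
    out at exponents \<open>l = m = 0\<close>.\<close>
  have eq_v: "deriv_v R = R + U * (w * R) + y * (2 * U * (1 + U * v) * R + 4 * U^2 * x * deriv_v R)
      + z * (2 * U * deriv_v R - U^2 * z * deriv_v R - U * (1 + U * w) * R)"
    using Rv unfolding D_def A_def by algebra
  have "fps5_nth (deriv_v R) i j 0 0 0 = fps5_nth (R + U * (w * R)) i j 0 0 0" for i j
    by (subst eq_v) (simp add: vars fps5_nth_var_mult)
  hence Rv0: "of_nat (Suc i) * fps5_nth R (Suc i) j 0 0 0 =
      fps5_nth R i j 0 0 0 + u * (if j = 0 then 0 else fps5_nth R i (j - 1) 0 0 0)" for i j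
    by (simp add: fps5_nth_deriv vars fps5_nth_var_mult U_def del: of_nat_Suc)
  \<comment> \<open>Here the multiple of \<open>v\<close> is separated too, since only the exponent
    \<open>i = 0\<close> is read off to obtain the initial row.\<close>
  have eq_w: "deriv_w R = R + v * (U * R) + x * (2 * U * (1 + U * w) * R + 4 * U^2 * y * deriv_w R)
      + z * (2 * U * deriv_w R - U^2 * z * deriv_w R - U * (1 + U * v) * R)"
    using Rw unfolding D_def B_def by algebra
  have "fps5_nth (deriv_w R) 0 j 0 0 0 = fps5_nth R 0 j 0 0 0" for j
    by (subst eq_w) (simp add: vars fps5_nth_var_mult)
  hence Rw0: "of_nat (Suc j) * fps5_nth R 0 (Suc j) 0 0 0 = fps5_nth R 0 j 0 0 0" for j
    by (simp only: fps5_nth_deriv)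
  have R0: "fps5_nth R 0 0 0 0 0 = 1"
  proof -
    \<comment> \<open>The constant coefficient of the reciprocal is read off from its product with
      \<open>fps5_sqrt D\<close>, whose own constant coefficient is 1.\<close>
    have "fps5_nth (1 / fps5_sqrt D * fps5_sqrt D) 0 0 0 0 0 = 1"
      using fps5_sqrt_square(2)[OF D0] by (subst fps5_divide_mult) (simp_all add: fps5_nth_1)
    thus ?thesis
      using fps5_sqrt_square(2)[OF D0]
      by (simp add: R_def fps5_nth_mult fps5_exp_def fps5_compose_def fps5_nth_1)
  qed

  have h0: "h 0 j 0 0 0 = 1" for j
  proof (induction j)
    case (Suc j)
    thus ?case
      using Rw0[of j] by (simp add: h_def mult_ac del: of_nat_Suc)
  qed (simp add: h_def R0)
  have h_Suc_0: "h (Suc i) 0 0 0 0 = h i 0 0 0 0" for i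
    using Rv0[of i 0] by (simp add: h_def mult_ac del: of_nat_Suc)
  have h_Suc_Suc: "h (Suc i) (Suc j) 0 0 0 = h i (Suc j) 0 0 0 + u * of_nat (Suc j) * h i j 0 0 0"
    for i j
  proof -
    have "h (Suc i) (Suc j) 0 0 0 =
        fact i * fact (Suc j) * (of_nat (Suc i) * fps5_nth R (Suc i) (Suc j) 0 0 0)"
      by (simp add: h_def mult_ac del: of_nat_Suc)
    also have "\<dots> = h i (Suc j) 0 0 0 + u * of_nat (Suc j) * h i j 0 0 0"
      unfolding Rv0 by (simp add: h_def distrib_left mult_ac del: of_nat_Suc)
    finally show ?thesis .
  qed
  \<comment> \<open>The recurrence lowers \<open>i\<close> in both terms but \<open>j\<close> in
    only one, so the induction is on \<open>i\<close> with \<open>j\<close> arbitrary.\<close>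
  have h_Hpoly: "h i j 0 0 0 = Hpoly i j u" for i j
  proof (induction i arbitrary: j)
    case (Suc i)
    thus ?case
      by (cases j) (simp_all only: h_Suc_0 h_Suc_Suc Hpoly_Suc_0 Hpoly_Suc_Suc)
  qed (simp add: h0 Hpoly_0_left)
  have "Hpoly (i + 2 * k + m) (j + 2 * l + m) u =
      fact i * fact j * fact k * fact l * fact m * fps5_nth R i j k l m" for i j k l m
    using red[of i j k l m] by (simp add: h_Hpoly) (simp add: h_def)
  hence "Abs_fps5 (\<lambda>i j k l m. Hpoly (i + 2 * k + m) (j + 2 * l + m) u /
      (fact i * fact j * fact k * fact l * fact m)) = R"
    by (intro fps5_eqI) simp
  thus ?thesis
    by (simp add: Let_def R_def D_def Q_def U_def vars)
qed

end
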